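(* There is an absolute constant $c>0$ such that for every $n$ and every $\varepsilon\in(1/\sqrt n,1)$, every sketch $\mathrm{sk}(A)$ for general $n\times n$ positive semidefinite matrices $A$ that satisfies the ``for each'' guarantee with relative approximation $\varepsilon$ (with constant probability of success, $0.9$) must use at least $c\,n/\varepsilon^2$ bits of space.
   Context: A sketch consists of a (possibly randomized) map $A\mapsto\mathrm{sk}(A)$ to bit strings and an estimation procedure $\mathrm{est}$ that sees only the query $x\in\mathbb R^n$ and $\mathrm{sk}(A)$ (and possibly shared random bits). It satisfies the ``for each'' guarantee with relative approximation $\varepsilon$ and success probability $p$ if for every positive semidefinite $A$ and every fixed $x\in\mathbb R^n$, with probability at least $p$: $(1-\varepsilon)x^TAx\le\mathrm{est}(x,\mathrm{sk}(A))\le(1+\varepsilon)x^TAx$. The space is the worst-case length of $\mathrm{sk}(A)$ over all $A$ and all random choices. *)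

theory Defs
  imports "HOL-Probability.Probability" "Jordan_Normal_Form.Matrix"
begin

text \<open>Matrices and vectors are those of \<open>Jordan_Normal_Form\<close>, whose dimension is a term and
  not a type, so that a constant can be chosen before \<open>n\<close> is quantified.\<close>

definition psd_mats :: "nat \<Rightarrow> real mat set" where
  "psd_mats n =
     {A \<in> carrier_mat n n. transpose_mat A = A \<and>
        (\<forall>x \<in> carrier_vec n. 0 \<le> scalar_prod x (A *\<^sub>v x))}"

text \<open>The random choices are a pair \<open>(r, s)\<close>: \<open>r\<close> is private to the sketching map, and \<open>s\<close>
  is available to the estimator and to the sketching map. Private coins of the estimator are the
  part of \<open>s\<close> that the sketching map ignores. A deterministic map ignores both components, and
  a sketch without shared randomness ignores \<open>s\<close> on the sketching side. Each component is an
  infinite bit sequence, and their joint distribution is an arbitrary probability measure.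
  The type of the randomness is deliberately concrete: with a type variable in its place, an
  absolute constant in a theorem could depend on the instance of that variable.\<close>

type_synonym coins = "nat \<Rightarrow> bool"
type_synonym sketch_map = "coins \<Rightarrow> coins \<Rightarrow> real mat \<Rightarrow> bool list"
type_synonym estimator = "coins \<Rightarrow> real vec \<Rightarrow> bool list \<Rightarrow> real"

text \<open>The success event is required to be measurable, since otherwise \<open>measure\<close> is a junk
  value. The quantifiers over \<open>A\<close> and \<open>x\<close> stand outside the probability: this is the
  ``for each'' guarantee and not ``for all''.\<close>

definition for_each_guarantee ::
  "nat \<Rightarrow> real \<Rightarrow> real \<Rightarrow> (coins \<times> coins) measure \<Rightarrow> sketch_map \<Rightarrow> estimator \<Rightarrow> bool" where
  "for_each_guarantee n \<epsilon> p M sk est \<longleftrightarrow>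
     (\<forall>A \<in> psd_mats n. \<forall>x \<in> carrier_vec n.
        let q = scalar_prod x (A *\<^sub>v x);
            good = {(r, s) \<in> space M.
                      (1 - \<epsilon>) * q \<le> est s x (sk r s A) \<and>
                      est s x (sk r s A) \<le> (1 + \<epsilon>) * q}
        in good \<in> sets M \<and> p \<le> measure M good)"

text \<open>Extended real, because the length of the sketch need not be bounded.\<close>

definition sketch_space :: "nat \<Rightarrow> (coins \<times> coins) measure \<Rightarrow> sketch_map \<Rightarrow> ereal" where
  "sketch_space n M sk =
     (SUP A \<in> psd_mats n. SUP (r, s) \<in> space M. ereal (real (length (sk r s A))))"

end

theory Submission
  imports Defs
begin

text \<open>Encode \<open>k (n - k)\<close> sign bits in a Gram matrix whose quadratic form at \<open>e\<^sub>i + e\<^sub>j\<close> is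
  \<open>2 \<plusminus> 2 / sqrt k\<close>, with the sign given by the bit \<open>(i, j)\<close>. For \<open>\<epsilon> < 1 / sqrt k\<close> a successful
  estimate reveals that bit, so by averaging, some fixed choice of the coins turns the sketch into
  a deterministic code that recovers nine tenths of all (input, bit) pairs. Bounding the
  exponential moment of the number of recovered bits by a sum over all possible messages shows
  that such a code has length linear in the number of bits. Taking \<open>k\<close> of order \<open>1 / \<epsilon>\<^sup>2\<close>
  gives the theorem.\<close>

section \<open>Code length bounds and an averaging argument\<close>

lemma card_bool_lists_length_le:
  "finite {w :: bool list. length w \<le> L}" "card {w :: bool list. length w \<le> L} < 2 ^ Suc L"
proof -
  have eq: "{w :: bool list. length w \<le> L} = {w. set w \<subseteq> UNIV \<and> length w \<le> L}" by simp
  show "finite {w :: bool list. length w \<le> L}"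
    unfolding eq by (rule finite_lists_length_le) simp
  have "card {w :: bool list. length w \<le> L} = (\<Sum>i\<le>L. 2 ^ i)"
    unfolding eq by (subst card_lists_length_le) (simp_all add: card_UNIV_bool)
  also have "\<dots> < 2 ^ Suc L"
    by (induction L) auto
  finally show "card {w :: bool list. length w \<le> L} < 2 ^ Suc L" .
qed

text \<open>Each \<open>p\<close> agrees with the fixed guess \<open>P\<close> for exactly one of
  the choices of putting it into \<open>S\<close> or not, so it contributes a factor
  \<open>1 + exp t\<close>. Expanding the product gives the exponential moment over all
  inputs.\<close>

lemma sum_Pow_exp_agreement:
  fixes t :: real
  assumes "finite I"
  shows "(\<Sum>S\<in>Pow I. exp (t * real (card {p\<in>I. p \<in> S \<longleftrightarrow> P p}))) = (1 + exp t) ^ card I"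
proof -
  define f where "f p = (if P p then exp t else 1)" for p
  define g where "g p = (if P p then 1 else exp t)" for p
  have "(1 + exp t) ^ card I = (\<Prod>p\<in>I. f p + g p)"
    by (subst prod_constant [symmetric], rule prod.cong) (auto simp: f_def g_def)
  also have "\<dots> = (\<Sum>S\<in>Pow I. (\<Prod>p\<in>S. f p) * (\<Prod>p\<in>I - S. g p))"
    using assms by (rule prod_add)
  also have "\<dots> = (\<Sum>S\<in>Pow I. exp (t * real (card {p\<in>I. p \<in> S \<longleftrightarrow> P p})))"
  proof (rule sum.cong [OF refl])
    fix S assume "S \<in> Pow I"
    then have S: "S \<subseteq> I" by simp
    have "(\<Prod>p\<in>S. f p) * (\<Prod>p\<in>I - S. g p)
        = (\<Prod>p\<in>I. if p \<in> S then f p else g p)"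
      using assms S by (simp add: prod.If_cases Int_absorb1 Diff_eq)
    also have "\<dots> = (\<Prod>p\<in>I. if p \<in> S \<longleftrightarrow> P p then exp t else 1)"
      by (rule prod.cong) (auto simp: f_def g_def)
    also have "\<dots> = exp t ^ card {p\<in>I. p \<in> S \<longleftrightarrow> P p}"
      using assms by (simp add: prod.If_cases Int_def)
    finally show "(\<Prod>p\<in>S. f p) * (\<Prod>p\<in>I - S. g p)
        = exp (t * real (card {p\<in>I. p \<in> S \<longleftrightarrow> P p}))"
      by (simp add: exp_of_nat2_mult)
  qed
  finally show ?thesis by simp
qed

text \<open>The left-hand side is \<open>exp (- 9/10 * t) * (1 + exp t)\<close> at \<open>t = 2\<close>. Any upper bound below 2
  gives a linear lower bound on the code length.\<close>

lemma exp_rate_le_sqrt_2: "exp (- 9/5) * (1 + exp 2) \<le> sqrt (2::real)"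
proof -
  have a: "exp (1/5) \<le> (124/100::real)"
    using exp_bound [of "1/5"] by (simp add: power2_eq_square)
  have b: "exp (9/5) \<ge> (59/10::real)"
  proof -
    \<comment> \<open>Splitting the exponent 9/5 into eight equal parts makes the quadratic Taylor
      bound sharp enough.\<close>
    have "(59/10::real) \<le> (5/4) ^ 8"
      by (simp add: power_divide)
    also have "exp (9/40::real) \<ge> 1 + 9/40 + (9/40)\<^sup>2 / 2"
      by (rule exp_lower_Taylor_quadratic) simp
    then have "(5/4::real) ^ 8 \<le> exp (9/40) ^ 8"
      by (intro power_mono) (simp_all add: power2_eq_square)
    also have "\<dots> = exp (9/5)"
      by (simp flip: exp_of_nat_mult)
    finally show ?thesis .
  qed
  have "exp (- 9/5) * (1 + exp 2) = exp (- 9/5) + exp (1/5::real)"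
    by (simp add: distrib_left flip: exp_add)
  also have "exp (- 9/5) \<le> inverse (59/10::real)"
    using le_imp_inverse_le [OF b] by (simp flip: exp_minus)
  also have "inverse (59/10) + exp (1/5) \<le> (141/100::real)" using a by simp
  also have "\<dots> \<le> sqrt 2" by (rule real_le_rsqrt) (simp add: power2_eq_square)
  finally show ?thesis by simp
qed

lemma code_length_lower_bound:
  fixes enc :: "'a set \<Rightarrow> bool list" and dec :: "bool list \<Rightarrow> 'a \<Rightarrow> bool"
  assumes I: "finite I" "I \<noteq> {}"
    and len: "\<And>S. S \<subseteq> I \<Longrightarrow> length (enc S) \<le> L"
    and agree: "9/10 * real (card I) * 2 ^ card I
      \<le> (\<Sum>S\<in>Pow I. real (card {p\<in>I. p \<in> S \<longleftrightarrow> dec (enc S) p}))"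
  shows "card I \<le> 4 * L"
proof -
  define m where "m = card I"
  define W where "W = {w :: bool list. length w \<le> L}"
  have m: "m \<ge> 1" using I by (simp add: m_def Suc_le_eq card_gt_0_iff)
  have W: "finite W" "card W < 2 ^ Suc L"
    unfolding W_def by (rule card_bool_lists_length_le)+
  define a where "a w S = real (card {p\<in>I. p \<in> S \<longleftrightarrow> dec w p})" for w S
  \<comment> \<open>The agreement hypothesis makes the sum of the linear terms nonnegative. The
    inequality \<open>1 + z \<le> exp z\<close> then passes to exponential moments.\<close>
  have "2 ^ m \<le> (\<Sum>S\<in>Pow I. 1 + 2 * (a (enc S) S - 9/10 * real m))"
  proof -
    have "(\<Sum>S\<in>Pow I. 1 + 2 * (a (enc S) S - 9/10 * real m))
      = 2 ^ m + 2 * ((\<Sum>S\<in>Pow I. a (enc S) S) - 9/10 * real m * 2 ^ m)"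
      using I by (simp add: sum.distrib sum_subtractf card_Pow m_def flip: sum_distrib_left)
    then show ?thesis using agree by (simp add: a_def m_def)
  qed
  also have "\<dots> \<le> (\<Sum>S\<in>Pow I. exp (2 * (a (enc S) S - 9/10 * real m)))"
    by (intro sum_mono exp_ge_add_one_self)
  \<comment> \<open>Summing over all messages removes the dependence of the message on
    \<open>S\<close>. After the swap, each inner sum has a fixed guess.\<close>
  also have "\<dots> \<le> (\<Sum>S\<in>Pow I. \<Sum>w\<in>W. exp (2 * (a w S - 9/10 * real m)))"
  proof (rule sum_mono)
    fix S assume "S \<in> Pow I"
    then have "enc S \<in> W" using len by (auto simp: W_def)
    then show "exp (2 * (a (enc S) S - 9/10 * real m))
        \<le> (\<Sum>w\<in>W. exp (2 * (a w S - 9/10 * real m)))"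
      using W by (intro member_le_sum) auto
  qed
  also have "\<dots> = (\<Sum>w\<in>W. \<Sum>S\<in>Pow I. exp (2 * (a w S - 9/10 * real m)))"
    by (rule sum.swap)
  also have "\<dots> = (\<Sum>w\<in>W. (exp (- 9/5) * (1 + exp 2)) ^ m)"
  proof (rule sum.cong [OF refl])
    fix w
    have "(\<Sum>S\<in>Pow I. exp (2 * (a w S - 9/10 * real m)))
        = (\<Sum>S\<in>Pow I. exp (- 9/5) ^ m * exp (2 * a w S))"
      by (rule sum.cong) (simp_all add: algebra_simps flip: exp_of_nat_mult exp_add)
    also have "\<dots> = exp (- 9/5) ^ m * (1 + exp 2) ^ m"
      using sum_Pow_exp_agreement [OF I(1), of 2 "dec w"]
      by (simp add: a_def m_def flip: sum_distrib_left)
    finally show "(\<Sum>S\<in>Pow I. exp (2 * (a w S - 9/10 * real m)))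
        = (exp (- 9/5) * (1 + exp 2)) ^ m"
      by (simp add: power_mult_distrib)
  qed
  also have "\<dots> \<le> (\<Sum>w\<in>W. sqrt 2 ^ m)"
    by (intro sum_mono power_mono exp_rate_le_sqrt_2) (simp add: add_nonneg_nonneg)
  finally have "2 ^ m \<le> real (card W) * sqrt 2 ^ m" by simp
  then have "sqrt 2 ^ m * sqrt 2 ^ m \<le> real (card W) * sqrt 2 ^ m"
    by (simp flip: power_mult_distrib)
  then have N: "sqrt 2 ^ m \<le> real (card W)" by simp
  then have "(sqrt 2 ^ m)\<^sup>2 \<le> (real (card W))\<^sup>2" by (intro power_mono) auto
  moreover have "(sqrt 2 ^ m)\<^sup>2 = (2::real) ^ m"
    by (metis power_mult mult.commute real_sqrt_pow2 zero_le_numeral)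
  ultimately have N2: "2 ^ m \<le> (real (card W))\<^sup>2" by simp
  \<comment> \<open>The final count gives only \<open>m \<le> 2 * L + 1\<close>, which is at most
    \<open>4 * L\<close> once \<open>L\<close> is positive.\<close>
  have "L \<noteq> 0"
  proof
    assume "L = 0"
    then have "card W \<le> 1" using W by simp
    then have "(real (card W))\<^sup>2 \<le> 1\<^sup>2" by (intro power_mono) auto
    moreover have "(2::real) ^ 1 \<le> 2 ^ m" using m by (intro power_increasing) auto
    ultimately show False using N2 by simp
  qed
  have "(real (card W))\<^sup>2 < (2 ^ Suc L)\<^sup>2"
  proof (rule power_strict_mono)
    have "real (card W) < real (2 ^ Suc L)" using W(2) by (simp only: of_nat_less_iff)
    then show "real (card W) < 2 ^ Suc L" by simp
  qed auto
  also have "(2 ^ Suc L)\<^sup>2 = (2::real) ^ (2 * Suc L)"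
    by (metis power_mult mult.commute)
  finally have "(2::real) ^ m < 2 ^ (2 * Suc L)" using N2 by linarith
  then have "m < 2 * Suc L" by (simp only: power_strict_increasing_iff)
  with \<open>L \<noteq> 0\<close> show ?thesis by (simp add: m_def)
qed

text \<open>By linearity, the expected number of events that occur is at least
  \<open>p * card J\<close>, and some point attains at least the mean.\<close>

lemma (in prob_space) exists_point_in_many_events:
  assumes "finite J" and G: "\<And>j. j \<in> J \<Longrightarrow> G j \<in> events"
    and p: "\<And>j. j \<in> J \<Longrightarrow> p \<le> prob (G j)"
  shows "\<exists>\<omega>\<in>space M. p * real (card J) \<le> real (card {j\<in>J. \<omega> \<in> G j})"
proof (rule ccontr)
  assume contra: "\<not> ?thesis"
  define f where "f \<omega> = (\<Sum>j\<in>J. indicator (G j) \<omega> :: real)" for \<omega>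
  have f: "f \<omega> = real (card {j\<in>J. \<omega> \<in> G j})" for \<omega>
    using assms(1) by (simp add: f_def indicator_def sum.If_cases Int_def)
  have int: "integrable M f"
    unfolding f_def using G
    by (intro Bochner_Integration.integrable_sum integrable_real_indicator) (auto simp: emeasure_eq_measure)
  have "expectation f < p * real (card J)"
    using contra by (intro expectation_less int) (auto simp: f not_le)
  moreover have "expectation f = (\<Sum>j\<in>J. prob (G j))"
    unfolding f_def using G
    by (subst Bochner_Integration.integral_sum)
       (auto intro!: integrable_real_indicator sum.cong simp: emeasure_eq_measure)
  moreover have "(\<Sum>j\<in>J. prob (G j)) \<ge> p * real (card J)"
    using sum_mono [of J "\<lambda>_. p" "\<lambda>j. prob (G j)"] p by (simp add: mult.commute)
  ultimately show False by simp
qed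

section \<open>Gram matrices that hide sign bits\<close>

text \<open>The columns are the standard basis of \<open>\<real>\<^sup>k\<close> followed by \<open>n - k\<close> sign vectors of unit length,
  so the Gram matrix is positive semidefinite whatever the signs.\<close>

definition sign_frame :: "nat \<Rightarrow> nat \<Rightarrow> (nat \<times> nat) set \<Rightarrow> real mat" where
  "sign_frame n k S = mat k n (\<lambda>(i, j).
     if j < k then (if i = j then 1 else 0) else (if (i, j) \<in> S then 1 else - 1) / sqrt (real k))"

definition sign_gram :: "nat \<Rightarrow> nat \<Rightarrow> (nat \<times> nat) set \<Rightarrow> real mat" where
  "sign_gram n k S = transpose_mat (sign_frame n k S) * sign_frame n k S"

lemma sign_frame_carrier [simp]: "sign_frame n k S \<in> carrier_mat k n"
  by (simp add: sign_frame_def)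

lemma quadratic_form_gram:
  fixes V :: "real mat"
  assumes V: "V \<in> carrier_mat k n" and x: "x \<in> carrier_vec n"
  shows "x \<bullet> ((transpose_mat V * V) *\<^sub>v x) = (V *\<^sub>v x) \<bullet> (V *\<^sub>v x)"
proof -
  have "x \<bullet> ((transpose_mat V * V) *\<^sub>v x) = x \<bullet> (transpose_mat V *\<^sub>v (V *\<^sub>v x))"
    using assms by (subst assoc_mult_mat_vec) auto
  also have "\<dots> = (V *\<^sub>v x) \<bullet> (V *\<^sub>v x)"
    using assms by (metis comm_scalar_prod mult_mat_vec_carrier transpose_carrier_mat
      transpose_vec_mult_scalar)
  finally show ?thesis .
qed

lemma sign_gram_psd: "sign_gram n k S \<in> psd_mats n"
proof -
  let ?V = "sign_frame n k S"
  have "transpose_mat (transpose_mat ?V * ?V) = transpose_mat ?V * ?V"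
    by (subst transpose_mult [of _ n k _ n]) auto
  moreover have "0 \<le> x \<bullet> ((transpose_mat ?V * ?V) *\<^sub>v x)" if "x \<in> carrier_vec n" for x
    unfolding quadratic_form_gram [OF sign_frame_carrier that]
    by (simp add: scalar_prod_def sum_nonneg)
  ultimately show ?thesis
    by (auto simp: psd_mats_def sign_gram_def intro: mult_carrier_mat [of _ n k])
qed

text \<open>The form is the squared norm of a sum of two unit vectors, a basis vector and a sign
  vector. Their inner product is coordinate \<open>i\<close> of the sign vector, so only the bit
  \<open>(i, j)\<close> survives.\<close>

lemma sign_gram_query:
  assumes i: "i < k" and j: "k \<le> j" "j < n"
  defines "x \<equiv> unit_vec n i + unit_vec n j"
  shows "x \<bullet> (sign_gram n k S *\<^sub>v x) = 2 + (if (i, j) \<in> S then 2 else - 2) / sqrt (real k)"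
proof -
  define \<sigma> :: "nat \<Rightarrow> real" where "\<sigma> l = (if (l, j) \<in> S then 1 else - 1)" for l
  let ?V = "sign_frame n k S"
  have x: "x \<in> carrier_vec n" by (simp add: x_def)
  have k: "real k > 0" using i by simp
  have \<sigma>2: "\<sigma> l * \<sigma> l = 1" for l by (simp add: \<sigma>_def)
  have Vx: "(?V *\<^sub>v x) $ l = (if l = i then 1 else 0) + \<sigma> l / sqrt (real k)" if "l < k" for l
  proof -
    have "(?V *\<^sub>v x) = ?V *\<^sub>v unit_vec n i + ?V *\<^sub>v unit_vec n j"
      unfolding x_def by (rule mult_add_distrib_mat_vec [OF sign_frame_carrier]) auto
    then show ?thesis
      using that i j by (auto simp: sign_frame_def \<sigma>_def)
  qed
  have "x \<bullet> (sign_gram n k S *\<^sub>v x) = (?V *\<^sub>v x) \<bullet> (?V *\<^sub>v x)"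
    unfolding sign_gram_def by (rule quadratic_form_gram [OF sign_frame_carrier x])
  also have "\<dots> = (\<Sum>l<k. ((?V *\<^sub>v x) $ l) * ((?V *\<^sub>v x) $ l))"
    by (simp add: scalar_prod_def sign_frame_def atLeast0LessThan)
  \<comment> \<open>Squaring erases the signs outside the cross term at
    \<open>l = i\<close>.\<close>
  also have "\<dots> = (\<Sum>l<k. (if l = i then 1 + 2 * \<sigma> i / sqrt (real k) else 0) + 1 / real k)"
  proof (rule sum.cong [OF refl])
    fix l assume "l \<in> {..<k}"
    then show "((?V *\<^sub>v x) $ l) * ((?V *\<^sub>v x) $ l)
      = (if l = i then 1 + 2 * \<sigma> i / sqrt (real k) else 0) + 1 / real k"
      using k \<sigma>2 [of l] by (simp add: Vx field_simps)
  qed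
  also have "\<dots> = 2 + 2 * \<sigma> i / sqrt (real k)"
    using i k by (simp add: sum.distrib)
  finally show ?thesis by (simp add: \<sigma>_def)
qed

text \<open>The two ranges for \<open>y\<close> end at \<open>2 - 2 * \<epsilon> * \<delta>\<close>
  plus or minus \<open>2 * (\<delta> - \<epsilon>)\<close>. The threshold is the midpoint of this
  gap.\<close>

lemma sign_decoding:
  fixes \<epsilon> \<delta> y :: real
  assumes "\<epsilon> < \<delta>"
    and q: "q = 2 + (if b then 2 else - 2) * \<delta>"
    and y: "(1 - \<epsilon>) * q \<le> y" "y \<le> (1 + \<epsilon>) * q"
  shows "b \<longleftrightarrow> y > 2 - 2 * \<epsilon> * \<delta>"
  using y \<open>\<epsilon> < \<delta>\<close> unfolding q by (cases b) (simp_all add: algebra_simps)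

section \<open>From sketches to codes\<close>

lemma sketch_length_lower_bound:
  assumes k: "1 \<le> k" "k < n" and eps: "\<epsilon> < 1 / sqrt (real k)"
    and "prob_space M" and guar: "for_each_guarantee n \<epsilon> (9/10) M sk est"
    and len: "\<And>A r s. A \<in> psd_mats n \<Longrightarrow> (r, s) \<in> space M \<Longrightarrow> length (sk r s A) \<le> L"
  shows "k * (n - k) \<le> 4 * L"
proof -
  interpret prob_space M by fact
  define I where "I = {..<k} \<times> {k..<n}"
  define x :: "nat \<times> nat \<Rightarrow> real vec" where "x = (\<lambda>(i, j). unit_vec n i + unit_vec n j)"
  define q where "q S p = x p \<bullet> (sign_gram n k S *\<^sub>v x p)" for S p
  define G where "G = (\<lambda>(S, p). {(r, s) \<in> space M.
      (1 - \<epsilon>) * q S p \<le> est s (x p) (sk r s (sign_gram n k S)) \<and>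
      est s (x p) (sk r s (sign_gram n k S)) \<le> (1 + \<epsilon>) * q S p})"
  have I: "finite I" "I \<noteq> {}" "card I = k * (n - k)" using k by (auto simp: I_def lessThan_empty_iff)
  have x: "x p \<in> carrier_vec n" for p by (simp add: x_def split: prod.split)
  have G: "G c \<in> events" "9/10 \<le> prob (G c)" for c
    using guar sign_gram_psd x
    unfolding for_each_guarantee_def G_def q_def Let_def by (auto split: prod.split)
  \<comment> \<open>The guarantee holds for each pair of an input and a query separately, so
    averaging over all pairs fixes one choice of coins that is good for nine tenths of them.\<close>
  have "\<exists>\<omega>\<in>space M. 9/10 * real (card (Pow I \<times> I)) \<le> real (card {c \<in> Pow I \<times> I. \<omega> \<in> G c})"
    using I G by (intro exists_point_in_many_events) auto
  then obtain r s where rs: "(r, s) \<in> space M"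
    and many: "9/10 * real (card (Pow I \<times> I)) \<le> real (card {c \<in> Pow I \<times> I. (r, s) \<in> G c})"
    by auto
  define enc where "enc S = sk r s (sign_gram n k S)" for S
  define dec where "dec w p \<longleftrightarrow> est s (x p) w > 2 - 2 * \<epsilon> * (1 / sqrt (real k))" for w p
  have dec: "p \<in> S \<longleftrightarrow> dec (enc S) p" if "p \<in> I" "(r, s) \<in> G (S, p)" for S p
    unfolding dec_def
  proof (rule sign_decoding [OF eps])
    obtain i j where p: "p = (i, j)" "i < k" "k \<le> j" "j < n"
      using \<open>p \<in> I\<close> by (auto simp: I_def)
    show "q S p = 2 + (if p \<in> S then 2 else - 2) * (1 / sqrt (real k))"
      unfolding q_def x_def p(1) using sign_gram_query [OF p(2-4), of S] by simp
    show "(1 - \<epsilon>) * q S p \<le> est s (x p) (enc S)" "est s (x p) (enc S) \<le> (1 + \<epsilon>) * q S p"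
      using that(2) by (auto simp: G_def enc_def)
  qed
  \<comment> \<open>Only an inclusion holds: a failed estimate may still yield the right
    bit.\<close>
  have "card {c \<in> Pow I \<times> I. (r, s) \<in> G c} \<le> card (SIGMA S:Pow I. {p\<in>I. p \<in> S \<longleftrightarrow> dec (enc S) p})"
    using I dec by (intro card_mono finite_SigmaI) auto
  also have "\<dots> = (\<Sum>S\<in>Pow I. card {p\<in>I. p \<in> S \<longleftrightarrow> dec (enc S) p})"
    using I by (intro card_SigmaI) auto
  finally have "9/10 * real (card (Pow I \<times> I))
      \<le> (\<Sum>S\<in>Pow I. real (card {p\<in>I. p \<in> S \<longleftrightarrow> dec (enc S) p}))"
    using many by (simp flip: of_nat_sum)
  then have "9/10 * real (card I) * 2 ^ card I
      \<le> (\<Sum>S\<in>Pow I. real (card {p\<in>I. p \<in> S \<longleftrightarrow> dec (enc S) p}))"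
    using I by (simp add: card_cartesian_product card_Pow mult_ac)
  then have "card I \<le> 4 * L"
    using I len sign_gram_psd rs
    by (intro code_length_lower_bound [where enc = enc and dec = dec]) (auto simp: enc_def)
  with I show ?thesis by simp
qed

section \<open>Block size and the final constant\<close>

text \<open>The witness is the floor of \<open>t = 1 / (2 * \<epsilon>\<^sup>2)\<close>, raised to 1
  if it vanishes. The lower bound on \<open>\<epsilon>\<close> gives \<open>2 * t < n\<close>, hence
  room for \<open>2 * k\<close>; the bound \<open>\<epsilon> < 1\<close> gives
  \<open>1 < 2 * t\<close>, so \<open>k < 2 * t\<close> even when \<open>k = 1\<close>.\<close>

lemma block_size_exists:
  assumes "1 / sqrt (real n) < \<epsilon>" "\<epsilon> < 1" "n \<ge> 1"
  shows "\<exists>k\<ge>1. 2 * k \<le> n \<and> \<epsilon> < 1 / sqrt (real k) \<and> 1 / (4 * \<epsilon>\<^sup>2) \<le> real k"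
proof -
  have e: "\<epsilon> > 0" using assms by (meson divide_nonneg_nonneg le_less_trans real_sqrt_ge_zero
    of_nat_0_le_iff zero_le_one)
  define t where "t = 1 / (2 * \<epsilon>\<^sup>2)"
  have "(1 / sqrt (real n))\<^sup>2 < \<epsilon>\<^sup>2" using assms by (intro power_strict_mono) auto
  then have n: "2 * t < real n" using e assms by (simp add: t_def power_divide field_simps)
  have "\<epsilon>\<^sup>2 < 1" using e assms by (simp add: power_less_one_iff abs_less_iff)
  then have t: "t > 1/2" using e by (simp add: t_def field_simps)
  define k where "k = max 1 (nat \<lfloor>t\<rfloor>)"
  have fl: "real (nat \<lfloor>t\<rfloor>) \<le> t" "t < real (nat \<lfloor>t\<rfloor>) + 1" using t by linarith+
  have k1: "k \<ge> 1" by (simp add: k_def)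
  have kt: "k = 1 \<or> real k \<le> t" using fl by (auto simp: k_def max_def)
  have "n \<ge> 2" using n t by linarith
  then have 1: "2 * k \<le> n" using kt n by auto
  have 2: "1 / (4 * \<epsilon>\<^sup>2) \<le> real k"
  proof -
    have "t / 2 \<le> real k"
      using fl(2) k1 max.cobounded2 [of "nat \<lfloor>t\<rfloor>" 1] unfolding k_def by linarith
    then show ?thesis by (simp add: t_def)
  qed
  have "real k < 2 * t" using kt t by auto
  then have "real k * \<epsilon>\<^sup>2 < 1" using e by (simp add: t_def field_simps)
  then have "sqrt (real k * \<epsilon>\<^sup>2) < 1" by simp
  then have "\<epsilon> < 1 / sqrt (real k)" using e k1 by (simp add: real_sqrt_mult field_simps)
  with 1 2 k1 show ?thesis by blast
qed

theorem theorem5p2: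
  shows "\<exists>c::real. c > 0 \<and>
    (\<forall>(n::nat) (\<epsilon>::real) (M :: (coins \<times> coins) measure) (sk :: sketch_map) (est :: estimator).
       n \<ge> 1 \<longrightarrow> 1 / sqrt (real n) < \<epsilon> \<longrightarrow> \<epsilon> < 1 \<longrightarrow>
       prob_space M \<longrightarrow> for_each_guarantee n \<epsilon> (9 / 10) M sk est \<longrightarrow>
       ereal (c * real n / \<epsilon>\<^sup>2) \<le> sketch_space n M sk)"
\<comment> \<open>The constant collects 1/4 from the size of \<open>k\<close>, 1/2 from
  \<open>n - k \<ge> n / 2\<close>, and 1/4 from the code length bound.\<close>
proof (intro exI [of _ "1/32"] conjI allI impI)
  fix n :: nat and \<epsilon> :: real and M :: "(coins \<times> coins) measure"
    and sk :: sketch_map and est :: estimator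
  assume n: "n \<ge> 1" and e: "1 / sqrt (real n) < \<epsilon>" "\<epsilon> < 1"
    and M: "prob_space M" and guar: "for_each_guarantee n \<epsilon> (9 / 10) M sk est"
  define t where "t = 1/32 * real n / \<epsilon>\<^sup>2"
  obtain k where k: "k \<ge> 1" "2 * k \<le> n" "\<epsilon> < 1 / sqrt (real k)" "1 / (4 * \<epsilon>\<^sup>2) \<le> real k"
    using block_size_exists [OF e n] by blast
  show "ereal (1/32 * real n / \<epsilon>\<^sup>2) \<le> sketch_space n M sk"
  proof (rule ccontr)
    assume "\<not> ereal (1/32 * real n / \<epsilon>\<^sup>2) \<le> sketch_space n M sk"
    then have lt: "sketch_space n M sk < ereal t" by (simp add: t_def)
    have short: "real (length (sk r s A)) < t" if "A \<in> psd_mats n" "(r, s) \<in> space M" for A r s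
    proof -
      have "ereal (real (length (sk r s A))) \<le> (SUP (r, s) \<in> space M. ereal (real (length (sk r s A))))"
        using that(2) by (rule SUP_upper2) simp
      also have "\<dots> \<le> sketch_space n M sk"
        unfolding sketch_space_def using that(1) by (rule SUP_upper)
      also note lt
      finally show ?thesis by simp
    qed
    \<comment> \<open>This is the largest integer strictly below \<open>t\<close>. It bounds all
      lengths while keeping \<open>L < t\<close>, which makes the contradiction strict;
      \<open>t > 0\<close> keeps \<open>nat\<close> from truncating.\<close>
    define L where "L = nat (\<lceil>t\<rceil> - 1)"
    have "t > 0" using n k(3) e by (auto simp: t_def zero_less_divide_iff)
    then have L: "real L < t" by (simp add: L_def) linarith
    have "length (sk r s A) \<le> L" if "A \<in> psd_mats n" "(r, s) \<in> space M" for A r s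
      using short [OF that] unfolding L_def by linarith
    then have "k * (n - k) \<le> 4 * L"
      using k by (intro sketch_length_lower_bound [OF _ _ k(3) M guar]) auto
    then have "real (k * (n - k)) < 4 * t" using L by linarith
    moreover have "1 / (4 * \<epsilon>\<^sup>2) * (real n / 2) \<le> real k * real (n - k)"
      using k by (intro mult_mono) auto
    ultimately show False by (simp add: t_def)
  qed
qed simp

end
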